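(* Let $r<t$ be coprime odd positive integers, let $\alpha=2^{1/(t^2-r^2)}$, let $a,b,c,d>0$, and let $T_{i,j,k}$ be the solution of the $T$-system with $2\times2$-periodic $(r,r,t)$-slanted initial data. For $m\ge t$, $i\in\mathbb Z$ and $k\in\mathbb Z$ with $k\equiv\theta m\pmod r$, let $$L^{2m}_{i,k}=\frac{T^{2m+r-t}_{i+1,k-1}\,T^{2m-r-t}_{i-1,k-1}}{T^{2m-2t}_{i,k-2}\,T^{2m}_{i,k}} .$$ Then: (1) For each $m$, the quantity $L^{2m}_{i,k}$, for $k\equiv\theta m\pmod r$, depends only on $i$ and $k$ modulo $2$. (2) $L^{2m+4t}_{i,k}=L^{2m}_{i,k}$, where by (1) both sides are regarded as functions of the residues of $i,k$ modulo $2$.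
   Context: All lattice points $(i,j,k)\in\mathbb Z^3$ considered satisfy $i+j+k\equiv0\pmod2$. The $T$-system is $T_{i,j,k+1}T_{i,j,k-1}=T_{i+1,j,k}T_{i-1,j,k}+T_{i,j+1,k}T_{i,j-1,k}$. Let $P_n=\{(i,j,k): r(i+j)+tk=n\}$. Since $r,t$ are odd, only even $n$ occur. The $2\times2$-periodic $(r,r,t)$-slanted initial data are: for every point $(i,j,k)\in P_n$ with $0\le n\le 2t-1$, $$T_{i,j,k}=\alpha^{n(n-1)/2}\times\begin{cases}a&(i,j)\equiv(0,0)\\ b&(i,j)\equiv(0,1)\\ c&(i,j)\equiv(1,0)\\ d&(i,j)\equiv(1,1)\end{cases}\pmod 2 .$$ They determine a unique positive solution $T_{i,j,k}$ at all points with $r(i+j)+tk\ge0$. Change of variables: $\theta\in[0,r-1]$ denotes the inverse of $\frac{t-r}{2}$ modulo $r$ (with $\theta=0$ if $r=1$). A point $(i,j,k)\in P_{2m}$ satisfies $k\equiv\theta m\pmod r$; conversely for $i,k,m\in\mathbb Z$ with $k\equiv\theta m\pmod r$ there is exactly one $j$ with $(i,j,k)\in P_{2m}$, namely $j=\frac{2m-tk}{r}-i$. One writes $T^{2m}_{i,k}:=T_{i,j,k}$. Since $r$ is odd, for every $m$ both parities of $k$ occur among the $k\equiv\theta m\pmod r$. *)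

theory Defs
  imports Complex_Main "HOL-Number_Theory.Number_Theory" "HOL-Number_Theory.Modular_Inverse"
begin

(* Arrays T on the lattice of points (i,j,k) with i+j+k even are represented by total
   functions int => int => int => real; the values at points with i+j+k odd, or with
   r*(i+j) + t*k < 0, are left unconstrained and are never used. *)

definition slanted_level :: "int \<Rightarrow> int \<Rightarrow> int \<Rightarrow> int \<Rightarrow> int \<Rightarrow> int" where
  "slanted_level r t i j k = r * (i + j) + t * k"

definition periodic_coeff :: "real \<Rightarrow> real \<Rightarrow> real \<Rightarrow> real \<Rightarrow> int \<Rightarrow> int \<Rightarrow> real" where
  "periodic_coeff a b c d i j =
     (if even i then (if even j then a else b) else (if even j then c else d))"

definition slanted_initial_data ::
    "int \<Rightarrow> int \<Rightarrow> real \<Rightarrow> real \<Rightarrow> real \<Rightarrow> real \<Rightarrow> real \<Rightarrow> (int \<Rightarrow> int \<Rightarrow> int \<Rightarrow> real) \<Rightarrow> bool" where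
  "slanted_initial_data r t \<alpha> a b c d T \<longleftrightarrow>
     (\<forall>i j k n. even (i + j + k) \<longrightarrow> n = slanted_level r t i j k \<longrightarrow> 0 \<le> n \<longrightarrow> n \<le> 2 * t - 1 \<longrightarrow>
        T i j k = \<alpha> powr (real_of_int (n * (n - 1)) / 2) * periodic_coeff a b c d i j)"

(* The T-system relation is centred at (i,j,k) with i+j+k odd, so that its six neighbours are
   lattice points.  For 0 < r < t the lowest neighbour is (i,j,k-1), so the condition below says
   that all six lie in the region r*(i+j) + t*k >= 0.  The highest one, (i,j,k+1), has level
   at least 2*t, so from positive initial data the relation determines T recursively, and T is
   positive throughout that region. *)
definition T_system :: "int \<Rightarrow> int \<Rightarrow> (int \<Rightarrow> int \<Rightarrow> int \<Rightarrow> real) \<Rightarrow> bool" where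
  "T_system r t T \<longleftrightarrow>
     (\<forall>i j k. odd (i + j + k) \<longrightarrow> 0 \<le> slanted_level r t i j (k - 1) \<longrightarrow>
        T i j (k + 1) * T i j (k - 1) =
          T (i + 1) j k * T (i - 1) j k + T i (j + 1) k * T i (j - 1) k)"

definition is_slanted_solution ::
    "int \<Rightarrow> int \<Rightarrow> real \<Rightarrow> real \<Rightarrow> real \<Rightarrow> real \<Rightarrow> real \<Rightarrow> (int \<Rightarrow> int \<Rightarrow> int \<Rightarrow> real) \<Rightarrow> bool" where
  "is_slanted_solution r t \<alpha> a b c d T \<longleftrightarrow>
     slanted_initial_data r t \<alpha> a b c d T \<and> T_system r t T"

(* For r = 1 this is 0. *)
definition theta :: "int \<Rightarrow> int \<Rightarrow> int" where
  "theta r t = modular_inverse r ((t - r) div 2)"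

(* T^n_{i,k} = T_{i,j,k} for the unique j with r*(i+j) + t*k = n; the division by r is exact
   for n = 2*m and k congruent to theta*m modulo r. *)
definition T_level ::
    "int \<Rightarrow> int \<Rightarrow> (int \<Rightarrow> int \<Rightarrow> int \<Rightarrow> real) \<Rightarrow> int \<Rightarrow> int \<Rightarrow> int \<Rightarrow> real" where
  "T_level r t T n i k = T i ((n - t * k) div r - i) k"

definition L_level ::
    "int \<Rightarrow> int \<Rightarrow> (int \<Rightarrow> int \<Rightarrow> int \<Rightarrow> real) \<Rightarrow> int \<Rightarrow> int \<Rightarrow> int \<Rightarrow> real" where
  "L_level r t T n i k =
     (T_level r t T (n + r - t) (i + 1) (k - 1) * T_level r t T (n - r - t) (i - 1) (k - 1)) /
     (T_level r t T (n - 2 * t) i (k - 2) * T_level r t T n i k)"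

end

theory Submission
  imports Defs
begin

text \<open>
  The solution inherits the periodicity of the initial data: it depends only on the level
  and on the parities of i and j.  Hence the right-hand side of the T-system is unchanged under
  the level-preserving shift (i,j) to (i+1,j-1), which merely swaps its two summands.  So the ratio
  of T at (i,j,k) to T at (i+1,j-1,k) is inverted by k to k+2 and is periodic under
  k to k+4, that is, under raising the level by 4t.  Finally L = x / (x + y), where x and y are
  the two summands, and x / y is a product of two such ratios.
\<close>

locale slanted_solution =
  fixes r t :: int and \<alpha> a b c d :: real and T :: "int \<Rightarrow> int \<Rightarrow> int \<Rightarrow> real"
  assumes r_pos: "0 < r" and r_less_t: "r < t" and odd_r: "odd r" and odd_t: "odd t"
    and \<alpha>_pos: "0 < \<alpha>" and data_pos: "0 < a" "0 < b" "0 < c" "0 < d"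
    and solution: "is_slanted_solution r t \<alpha> a b c d T"
begin

section \<open>Positivity of the solution and its dependence on level and parities\<close>

lemma T_initial:
  assumes "even (i + j + k)" "0 \<le> slanted_level r t i j k" "slanted_level r t i j k \<le> 2 * t - 1"
  shows "T i j k = \<alpha> powr (real_of_int (slanted_level r t i j k * (slanted_level r t i j k - 1)) / 2)
    * periodic_coeff a b c d i j"
  using solution assms unfolding is_slanted_solution_def slanted_initial_data_def by blast

lemma T_recurrence:
  assumes "even (i + j + k)" "0 \<le> slanted_level r t i j k"
  shows "T i j (k + 2) * T i j k =
    T (i + 1) j (k + 1) * T (i - 1) j (k + 1) + T i (j + 1) (k + 1) * T i (j - 1) (k + 1)"
proof -
  have "odd (i + j + (k + 1))" "0 \<le> slanted_level r t i j (k + 1 - 1)"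
    using assms by auto
  then have "T i j (k + 1 + 1) * T i j (k + 1 - 1) =
    T (i + 1) j (k + 1) * T (i - 1) j (k + 1) + T i (j + 1) (k + 1) * T i (j - 1) (k + 1)"
    using solution unfolding is_slanted_solution_def T_system_def by blast
  then show ?thesis by (simp add: add.assoc)
qed

text \<open>Strong induction on the level, phrased as one move of the recurrence. At level at least
  2t the top value is determined by five lower ones; since 0 < r < t the lowest of them is exactly
  2t below, so all five still have nonnegative level.\<close>

lemma level_induct [consumes 2, case_names initial step]:
  assumes "even (i + j + k)" "0 \<le> slanted_level r t i j k"
    and initial: "\<And>i j k. even (i + j + k) \<Longrightarrow> 0 \<le> slanted_level r t i j k \<Longrightarrow>
      slanted_level r t i j k \<le> 2 * t - 1 \<Longrightarrow> P i j k"
    and step: "\<And>i j k. even (i + j + k) \<Longrightarrow> 0 \<le> slanted_level r t i j k \<Longrightarrow> P i j k \<Longrightarrow>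
      P (i + 1) j (k + 1) \<Longrightarrow> P (i - 1) j (k + 1) \<Longrightarrow> P i (j + 1) (k + 1) \<Longrightarrow>
      P i (j - 1) (k + 1) \<Longrightarrow> P i j (k + 2)"
  shows "P i j k"
  using assms(1,2)
proof (induction "nat (slanted_level r t i j k)" arbitrary: i j k rule: less_induct)
  case less
  show ?case
  proof (cases "slanted_level r t i j k \<le> 2 * t - 1")
    case True
    then show ?thesis using initial less.prems by blast
  next
    case False
    have lev: "slanted_level r t i j (k - 2) = slanted_level r t i j k - 2 * t"
      "slanted_level r t (i + 1) j (k - 1) = slanted_level r t i j k - t + r"
      "slanted_level r t (i - 1) j (k - 1) = slanted_level r t i j k - t - r"
      "slanted_level r t i (j + 1) (k - 1) = slanted_level r t i j k - t + r"
      "slanted_level r t i (j - 1) (k - 1) = slanted_level r t i j k - t - r"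
      by (simp_all add: slanted_level_def algebra_simps)
    have "P i j (k - 2)" "P (i + 1) j (k - 1)" "P (i - 1) j (k - 1)"
      "P i (j + 1) (k - 1)" "P i (j - 1) (k - 1)"
      using False less.prems r_pos r_less_t by (auto intro!: less.hyps simp: lev)
    then show ?thesis
      using step[of i j "k - 2"] False less.prems lev(1) by simp
  qed
qed

lemma T_pos:
  assumes "even (i + j + k)" "0 \<le> slanted_level r t i j k"
  shows "0 < T i j k"
  using assms
proof (induction rule: level_induct)
  case (initial i j k)
  then show ?case using \<alpha>_pos data_pos by (simp add: T_initial periodic_coeff_def)
next
  case (step i j k)
  have "0 < T i j (k + 2) * T i j k"
    unfolding T_recurrence[OF step.hyps] using step.IH by (intro add_pos_pos mult_pos_pos)
  then show ?case using step.IH(1) by (simp add: zero_less_mult_iff)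
qed

text \<open>In the initial data the power of \<alpha> sees only the level, and the coefficient only
  the parities. The recurrence preserves this: corresponding neighbours of the two centres again
  agree in level and parities, and the equal positive bottom values cancel.\<close>

lemma T_cong:
  assumes "even (i + j + k)" "0 \<le> slanted_level r t i j k"
    and "slanted_level r t i' j' k' = slanted_level r t i j k"
    and "even (i' - i)" "even (j' - j)"
  shows "T i' j' k' = T i j k"
  using assms
proof (induction arbitrary: i' j' k' rule: level_induct)
  case (initial i j k)
  \<comment> \<open>As r and t are odd, the level has the parity of i + j + k, so equality of levels
    puts the primed point on the lattice.\<close>
  have "even (slanted_level r t i' j' k')" using initial odd_r odd_t by (simp add: slanted_level_def)
  then have "even (i' + j' + k')" using odd_r odd_t by (simp add: slanted_level_def)
  moreover have "periodic_coeff a b c d i' j' = periodic_coeff a b c d i j"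
    using initial by (auto simp: periodic_coeff_def)
  ultimately show ?case using initial by (simp add: T_initial)
next
  case (step i j k)
  define l where "l = k' - 2"
  have l: "slanted_level r t i' j' l = slanted_level r t i j k"
    using step.prems by (simp add: l_def slanted_level_def algebra_simps)
  have "even (slanted_level r t i' j' l)" unfolding l
    using step.hyps odd_r odd_t by (simp add: slanted_level_def)
  then have even_l: "even (i' + j' + l)" using odd_r odd_t by (simp add: slanted_level_def)
  have "T i' j' (l + 2) * T i' j' l = T i j (k + 2) * T i j k"
  proof -
    have "T (i' + 1) j' (l + 1) = T (i + 1) j (k + 1)" "T (i' - 1) j' (l + 1) = T (i - 1) j (k + 1)"
      "T i' (j' + 1) (l + 1) = T i (j + 1) (k + 1)" "T i' (j' - 1) (l + 1) = T i (j - 1) (k + 1)"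
      by (intro step.IH; use step.prems l in \<open>simp add: slanted_level_def algebra_simps\<close>)+
    then show ?thesis using T_recurrence[OF step.hyps] T_recurrence[OF even_l] l step.hyps by simp
  qed
  moreover have "T i' j' l = T i j k" using step.prems l by (intro step.IH) auto
  moreover have "0 < T i j k" using T_pos step.hyps by blast
  ultimately show ?case by (simp add: l_def)
qed

section \<open>Ratios along the diagonal direction (1,-1)\<close>

lemma T_diagonal_shift:
  assumes "even (i + j + k)" "0 \<le> slanted_level r t i j k"
  shows "T (i + 1) (j - 1) (k + 2) * T (i + 1) (j - 1) k = T i j (k + 2) * T i j k"
proof -
  have nonneg: "0 \<le> slanted_level r t i j k + t - r" "0 \<le> slanted_level r t i j k + t + r"
    using assms r_pos r_less_t by auto
  \<comment> \<open>The old and new centres share the neighbours (i+1,j) and (i,j-1). Each of the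
    other two new neighbours differs from an old one by (2,-2,0), which changes neither level nor
    parities.\<close>
  have "T (i + 2) (j - 1) (k + 1) = T i (j + 1) (k + 1)"
    using assms nonneg by (intro T_cong) (auto simp: slanted_level_def algebra_simps)
  moreover have "T (i + 1) (j - 2) (k + 1) = T (i - 1) j (k + 1)"
    using assms nonneg by (intro T_cong) (auto simp: slanted_level_def algebra_simps)
  moreover have "even ((i + 1) + (j - 1) + k)" "0 \<le> slanted_level r t (i + 1) (j - 1) k"
    using assms by (auto simp: slanted_level_def)
  ultimately show ?thesis
    using T_recurrence[OF assms] T_recurrence[of "i + 1" "j - 1" k] by (simp add: algebra_simps)
qed

text \<open>The instances of \<open>T_diagonal_shift\<close> at \<open>k\<close> and
  \<open>k + 2\<close> both involve the values at height \<open>k + 2\<close>; eliminating these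
  positive values links \<open>k\<close> directly to \<open>k + 4\<close>.\<close>

lemma T_ratio_periodic:
  assumes "even (i + j + k)" "0 \<le> slanted_level r t i j k"
  shows "T i j (k + 4) / T (i + 1) (j - 1) (k + 4) = T i j k / T (i + 1) (j - 1) k"
proof -
  have up: "0 \<le> slanted_level r t i j (k + 2)" "0 \<le> slanted_level r t i j (k + 4)"
    using assms r_pos r_less_t by (auto simp: slanted_level_def algebra_simps)
  have "0 < T i j l" "0 < T (i + 1) (j - 1) l" if "l \<in> {k, k + 2, k + 4}" for l
    using that assms up by (auto intro!: T_pos simp: slanted_level_def)
  moreover have "T (i + 1) (j - 1) (k + 4) * T (i + 1) (j - 1) (k + 2) = T i j (k + 4) * T i j (k + 2)"
    using T_diagonal_shift[of i j "k + 2"] assms up by (simp add: add.assoc)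
  then have "T i j (k + 2) * (T i j (k + 4) * T (i + 1) (j - 1) k) =
      T (i + 1) (j - 1) (k + 4) * (T (i + 1) (j - 1) (k + 2) * T (i + 1) (j - 1) k)"
    by (simp add: mult.assoc[symmetric] mult.commute[of "T i j (k + 2)"])
  then have "T i j (k + 2) * (T i j (k + 4) * T (i + 1) (j - 1) k) =
      T i j (k + 2) * (T i j k * T (i + 1) (j - 1) (k + 4))"
    unfolding T_diagonal_shift[OF assms] by (simp add: ac_simps)
  ultimately show ?thesis
    by (simp add: frac_eq_eq less_imp_neq[symmetric])
qed

section \<open>The quantity L in lattice coordinates\<close>

definition L :: "int \<Rightarrow> int \<Rightarrow> int \<Rightarrow> real" where
  "L i j k = T (i + 1) j (k - 1) * T (i - 1) j (k - 1) / (T i j (k - 2) * T i j k)"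

lemma L_cong:
  assumes "even (i + j + k)" "2 * t \<le> slanted_level r t i j k"
    and "slanted_level r t i' j' k' = slanted_level r t i j k"
    and "even (i' - i)" "even (j' - j)"
  shows "L i' j' k' = L i j k"
proof -
  have "T (i' + 1) j' (k' - 1) = T (i + 1) j (k - 1)" "T (i' - 1) j' (k' - 1) = T (i - 1) j (k - 1)"
    "T i' j' (k' - 2) = T i j (k - 2)" "T i' j' k' = T i j k"
    by (intro T_cong; use assms r_pos r_less_t in \<open>simp add: slanted_level_def algebra_simps\<close>)+
  then show ?thesis by (simp add: L_def)
qed

text \<open>By the recurrence the denominator of \<open>L\<close> is its numerator plus the other
  summand, so 1/L is 1 plus the quotient of the summands. That quotient is grouped into two diagonal
  ratios, the form to which \<open>T_ratio_periodic\<close> applies.\<close>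

lemma L_eq:
  assumes "even (i + j + k)" "2 * t \<le> slanted_level r t i j k"
  shows "1 / L i j k = 1 + (T i (j + 1) (k - 1) / T (i + 1) j (k - 1)) /
    (T (i - 1) j (k - 1) / T i (j - 1) (k - 1))"
proof -
  have "0 < T (i + 1) j (k - 1)" "0 < T (i - 1) j (k - 1)"
    using assms r_pos r_less_t by (auto intro!: T_pos simp: slanted_level_def algebra_simps)
  moreover have "T i j k * T i j (k - 2) = T (i + 1) j (k - 1) * T (i - 1) j (k - 1)
      + T i (j + 1) (k - 1) * T i (j - 1) (k - 1)"
    using T_recurrence[of i j "k - 2"] assms by (simp add: slanted_level_def algebra_simps)
  ultimately show ?thesis by (simp add: L_def field_simps)
qed

lemma L_periodic:
  assumes "even (i + j + k)" "2 * t \<le> slanted_level r t i j k"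
  shows "L i j (k + 4) = L i j k"
proof -
  \<comment> \<open>The terms \<open>j + 1 - 1\<close> and, below, \<open>i - 1 + 1\<close> are kept
    unsimplified so that both facts are literal instances of
    \<open>T_ratio_periodic\<close>.\<close>
  have "T i (j + 1) (k - 1 + 4) / T (i + 1) (j + 1 - 1) (k - 1 + 4) =
      T i (j + 1) (k - 1) / T (i + 1) (j + 1 - 1) (k - 1)"
    using assms r_pos r_less_t
    by (intro T_ratio_periodic) (auto simp: slanted_level_def algebra_simps)
  moreover have "T (i - 1) j (k - 1 + 4) / T (i - 1 + 1) (j - 1) (k - 1 + 4) =
      T (i - 1) j (k - 1) / T (i - 1 + 1) (j - 1) (k - 1)"
    using assms r_pos r_less_t
    by (intro T_ratio_periodic) (auto simp: slanted_level_def algebra_simps)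
  moreover have "2 * t \<le> slanted_level r t i j (k + 4)"
    using assms r_pos r_less_t by (simp add: slanted_level_def algebra_simps)
  ultimately have "1 / L i j (k + 4) = 1 / L i j k"
    using L_eq[OF assms] L_eq[of i j "k + 4"] assms by simp
  then show ?thesis by simp
qed

section \<open>Passage to the coordinates level, i and k\<close>

lemma L_level_eq:
  assumes "r * s = n - t * k"
  shows "L_level r t T n i k = L i (s - i) k"
proof -
  \<comment> \<open>Here \<open>s\<close> stands for i + j. In each factor the change of level
    matches the changes of i and k, so every division by r is exact and all four factors have j = s
    - i.\<close>
  have "n + r - t - t * (k - 1) = r * (s + 1)" "n - r - t - t * (k - 1) = r * (s - 1)"
    "n - 2 * t - t * (k - 2) = r * s" "n - t * k = r * s"
    using assms by (simp_all add: algebra_simps)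
  then show ?thesis using r_pos by (simp add: L_level_def T_level_def L_def)
qed

text \<open>From r s + t k = 2m with r and t odd, s has the parity of k. Hence the parities of i and
  k determine that of j = s - i, and \<open>L_cong\<close> applies.\<close>

lemma L_level_cong:
  assumes "t \<le> m" "r dvd 2 * m - t * k" "r dvd 2 * m - t * k'" "even (i' - i)" "even (k' - k)"
  shows "L_level r t T (2 * m) i' k' = L_level r t T (2 * m) i k"
proof -
  obtain s s' where s: "r * s = 2 * m - t * k" "r * s' = 2 * m - t * k'"
    using assms by (metis dvd_def)
  then have "even (r * s + t * k)" "even (r * s' + t * k')" by auto
  then have par: "even s = even k" "even s' = even k'" using odd_r odd_t by auto
  have "L i' (s' - i') k' = L i (s - i) k"
    using assms s par odd_r odd_t by (intro L_cong) (auto simp: slanted_level_def)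
  then show ?thesis using s by (simp add: L_level_eq)
qed

lemma L_level_periodic:
  assumes "t \<le> m" "r dvd 2 * m - t * k"
  shows "L_level r t T (2 * m + 4 * t) i (k + 4) = L_level r t T (2 * m) i k"
proof -
  obtain s where s: "r * s = 2 * m - t * k" using assms by (metis dvd_def)
  then have "even (r * s + t * k)" by auto
  then have par: "even s = even k" using odd_r odd_t by auto
  \<comment> \<open>Raising the level by 4t and k by 4 leaves s, and with it j, unchanged.\<close>
  have s': "r * s = 2 * m + 4 * t - t * (k + 4)" using s by (simp add: algebra_simps)
  have "L i (s - i) (k + 4) = L i (s - i) k"
    using assms s par odd_r odd_t by (intro L_periodic) (auto simp: slanted_level_def)
  then show ?thesis by (simp only: L_level_eq[OF s] L_level_eq[OF s'])
qed

end

text \<open>With h = (t - r)/2 one has t = r + 2h, so h is a unit modulo r and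
  \<open>theta r t\<close> is its inverse. Therefore t k is congruent to 2 h theta m, that is to
  2m.\<close>

lemma dvd_level_if_cong_theta:
  fixes r t :: int
  assumes "odd r" "odd t" "coprime r t" and k: "[k = theta r t * m] (mod r)"
  shows "r dvd 2 * m - t * k"
proof -
  define h where "h = (t - r) div 2"
  have t: "t = r + 2 * h" using assms by (simp add: h_def)
  have "coprime r h"
    using \<open>coprime r t\<close> unfolding t by (metis coprime_iff_gcd_eq_1 coprime_mult_right_iff gcd_add2)
  then have "[h * theta r t = 1] (mod r)"
    unfolding theta_def h_def[symmetric] by (intro cong_modular_inverse1) (simp add: coprime_commute)
  then have "[2 * m * (h * theta r t) = 2 * m * 1] (mod r)" by (rule cong_scalar_left)
  moreover have "[t * k = (2 * h) * (theta r t * m)] (mod r)"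
    using k by (intro cong_mult) (simp_all add: t cong_def)
  ultimately have "[t * k = 2 * m] (mod r)"
    by (simp add: ac_simps) (metis cong_trans)
  then show ?thesis by (simp add: cong_iff_dvd_diff dvd_diff_commute)
qed

theorem theorem4p2:
  fixes r t :: int and \<alpha> a b c d :: real and T :: "int \<Rightarrow> int \<Rightarrow> int \<Rightarrow> real"
  assumes "0 < r" and "r < t" and "odd r" and "odd t" and "coprime r t"
    and "\<alpha> = 2 powr (1 / real_of_int (t\<^sup>2 - r\<^sup>2))"
    and "0 < a" and "0 < b" and "0 < c" and "0 < d"
    and "is_slanted_solution r t \<alpha> a b c d T"
  shows "(\<forall>m\<ge>t. \<forall>i k i' k'.
            [k = theta r t * m] (mod r) \<longrightarrow> [k' = theta r t * m] (mod r) \<longrightarrow>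
            [i = i'] (mod 2) \<longrightarrow> [k = k'] (mod 2) \<longrightarrow>
            L_level r t T (2 * m) i k = L_level r t T (2 * m) i' k')
       \<and> (\<forall>m\<ge>t. \<forall>i k i' k'.
            [k = theta r t * m] (mod r) \<longrightarrow> [k' = theta r t * (m + 2 * t)] (mod r) \<longrightarrow>
            [i = i'] (mod 2) \<longrightarrow> [k = k'] (mod 2) \<longrightarrow>
            L_level r t T (2 * m + 4 * t) i' k' = L_level r t T (2 * m) i k)"
proof -
  have "0 < \<alpha>" using assms(6) by simp
  then interpret slanted_solution r t \<alpha> a b c d T
    using assms by unfold_locales auto
  note lev = dvd_level_if_cong_theta[OF assms(3,4,5)]
  have par: "even (y - x)" if "[x = y] (mod 2)" for x y :: int
    using that by (metis cong_iff_dvd_diff cong_sym)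
  show ?thesis
  proof (intro conjI allI impI)
    fix m i k i' k' :: int
    assume "t \<le> m" "[k = theta r t * m] (mod r)" "[k' = theta r t * m] (mod r)"
      "[i = i'] (mod 2)" "[k = k'] (mod 2)"
    then show "L_level r t T (2 * m) i k = L_level r t T (2 * m) i' k'"
      using L_level_cong[of m k k' i' i] lev par by simp
  next
    fix m i k i' k' :: int
    assume *: "t \<le> m" "[k = theta r t * m] (mod r)" "[k' = theta r t * (m + 2 * t)] (mod r)"
      "[i = i'] (mod 2)" "[k = k'] (mod 2)"
    \<comment> \<open>\<open>L_level_periodic\<close> reaches only \<open>k + 4\<close> at the
      raised level. This index is admissible there and has the parity of k', so the first claim at m
      + 2t exchanges the two.\<close>
    have "r dvd 2 * (m + 2 * t) - t * (k + 4)"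
      using lev[OF *(2)] by (simp add: algebra_simps)
    moreover have "even (k' - (k + 4))" using par[OF *(5)] by simp
    moreover have "t \<le> m + 2 * t" using * assms by linarith
    ultimately have "L_level r t T (2 * (m + 2 * t)) i' k' = L_level r t T (2 * (m + 2 * t)) i (k + 4)"
      using L_level_cong[of "m + 2 * t" "k + 4" k' i' i] lev[OF *(3)] par[OF *(4)] by simp
    then show "L_level r t T (2 * m + 4 * t) i' k' = L_level r t T (2 * m) i k"
      using L_level_periodic[OF *(1) lev[OF *(2)]] by (simp add: algebra_simps)
  qed
qed

end
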